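(* Let $A\times X\to Y$, $(a,x)\mapsto ax$, be a Banach action such that $A$ is a Hilbert space possessing an orthonormal basis $(e_n)_{n\in\omega}$ such that for every $x\in X$ the series $\sum_{n\in\omega}e_nx$ is weakly absolutely convergent in $Y$. Then the Banach action $A\times X\to Y$ is unconditional.
   Context: All Banach spaces are over the field $\mathbb F$ of real or complex numbers; $\omega=\{0,1,2,\dots\}$, $\mathbb N=\omega\setminus\{0\}$, and each $n\in\omega$ is identified with the set $\{0,\dots,n-1\}$. A Banach action is a continuous bilinear function $A\times X\to Y$, $(a,x)\mapsto ax$, where $A,X,Y$ are Banach spaces (over the same field $\mathbb F$). A series $\sum_{n\in\omega}y_n$ in a Banach space $Y$ is weakly absolutely convergent if $\sum_{n\in\omega}|y^*(y_n)|<\infty$ for every continuous linear functional $y^*$ on $Y$. A Banach action $A\times X\to Y$ is called unconditional if there exists a positive real number $C$ such that for every $n\in\mathbb N$ and all sequences $(a_k)_{k\in n}$ in $A$ and $(x_k)_{k\in n}$ in $X$ we have $$\Big\|\sum_{k\in n}a_kx_k\Big\|_Y\le C\cdot\max_{k\in n}\|a_k\|_A\cdot\max_{F\subseteq n}\Big\|\sum_{k\in F}x_k\Big\|_X.$$ *)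

theory Defs
  imports "HOL-Analysis.Analysis"
begin

text \<open>
  The scalar field \<open>\<bbbF>\<close> is either the reals or the complex numbers.  Up to isometric isomorphism
  these are the only members of the following class: \<open>imag_unit\<close> is \<open>0\<close> in the real case and
  a square root of \<open>-1\<close> in the complex case, and together with the reals it generates the field.
\<close>

class real_or_complex = real_normed_field +
  fixes conjugate :: "'a \<Rightarrow> 'a"
    and imag_unit :: 'a
  assumes imag_unit: "imag_unit = 0 \<or> imag_unit * imag_unit = - 1"
    and re_im_decomposition: "\<exists>a b. z = a *\<^sub>R 1 + b *\<^sub>R imag_unit"
    and conjugate_re_im:
      "conjugate (a *\<^sub>R 1 + b *\<^sub>R imag_unit) = a *\<^sub>R 1 - b *\<^sub>R imag_unit"
    and mult_conjugate: "z * conjugate z = (norm z)\<^sup>2 *\<^sub>R 1"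

instantiation real :: real_or_complex
begin

definition conjugate_real :: "real \<Rightarrow> real" where "conjugate_real z = z"
definition imag_unit_real :: real where "imag_unit_real = 0"

instance
  by standard (auto simp: conjugate_real_def imag_unit_real_def power2_eq_square)

end

instantiation complex :: real_or_complex
begin

definition conjugate_complex :: "complex \<Rightarrow> complex" where "conjugate_complex = cnj"
definition imag_unit_complex :: complex where "imag_unit_complex = \<i>"

instance
proof
  fix z :: complex
  have "z = Re z *\<^sub>R 1 + Im z *\<^sub>R \<i>"
    by (simp add: complex_eq_iff)
  then show "\<exists>a b. z = a *\<^sub>R 1 + b *\<^sub>R imag_unit"
    unfolding imag_unit_complex_def by blast
  show "z * conjugate z = (norm z)\<^sup>2 *\<^sub>R 1"
    by (simp add: conjugate_complex_def complex_norm_square [symmetric] scaleR_conv_of_real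
        del: of_real_power)
qed (simp_all add: conjugate_complex_def imag_unit_complex_def)

end

text \<open>
  A Banach space over \<open>\<bbbF>\<close> is a type of class \<^class>\<open>banach\<close>, i.e. a complete normed space over the
  reals, with a multiplication \<open>scale\<close> by scalars from \<open>\<bbbF>\<close> that extends the one by reals.
\<close>

locale banach_space_over = vector_space scale
  for scale :: "'f::real_or_complex \<Rightarrow> 'x::banach \<Rightarrow> 'x" +
  assumes norm_scale: "norm (scale c x) = norm c * norm x"
    and scale_of_real: "scale (of_real r) x = r *\<^sub>R x"

text \<open>The inner product is linear in its first and conjugate-linear in its second argument.\<close>

locale hilbert_space_over = banach_space_over scale
  for scale :: "'f::real_or_complex \<Rightarrow> 'x::banach \<Rightarrow> 'x" +
  fixes ip :: "'x \<Rightarrow> 'x \<Rightarrow> 'f"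
  assumes ip_add: "ip (x + y) z = ip x z + ip y z"
    and ip_scale: "ip (scale c x) z = c * ip x z"
    and ip_commute: "ip x y = conjugate (ip y x)"
    and ip_self: "ip x x = of_real ((norm x)\<^sup>2)"
begin

definition orthonormal_basis :: "(nat \<Rightarrow> 'x) \<Rightarrow> bool" where
  "orthonormal_basis e \<longleftrightarrow>
     (\<forall>m n. ip (e m) (e n) = (if m = n then 1 else 0)) \<and> closure (span (range e)) = UNIV"

end

locale banach_action =
  A: banach_space_over scaleA + X: banach_space_over scaleX + Y: banach_space_over scaleY
  for scaleA :: "'f::real_or_complex \<Rightarrow> 'a::banach \<Rightarrow> 'a"
    and scaleX :: "'f \<Rightarrow> 'x::banach \<Rightarrow> 'x"
    and scaleY :: "'f \<Rightarrow> 'y::banach \<Rightarrow> 'y" +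
  fixes act :: "'a \<Rightarrow> 'x \<Rightarrow> 'y"
  assumes linear_left: "Vector_Spaces.linear scaleA scaleY (\<lambda>a. act a x)"
    and linear_right: "Vector_Spaces.linear scaleX scaleY (\<lambda>x. act a x)"
    and continuous_act: "continuous_on UNIV (\<lambda>(a, x). act a x)"

definition weakly_absolutely_convergent ::
    "('f::real_or_complex \<Rightarrow> 'y::banach \<Rightarrow> 'y) \<Rightarrow> (nat \<Rightarrow> 'y) \<Rightarrow> bool" where
  "weakly_absolutely_convergent s y \<longleftrightarrow>
     (\<forall>f :: 'y \<Rightarrow> 'f. Vector_Spaces.linear s (*) f \<and> continuous_on UNIV f \<longrightarrow>
        summable (\<lambda>n. norm (f (y n))))"

definition unconditional_action :: "('a::banach \<Rightarrow> 'x::banach \<Rightarrow> 'y::banach) \<Rightarrow> bool" where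
  "unconditional_action act \<longleftrightarrow>
     (\<exists>C>0. \<forall>n\<ge>1. \<forall>(a :: nat \<Rightarrow> 'a) (x :: nat \<Rightarrow> 'x).
        norm (\<Sum>k<n. act (a k) (x k))
          \<le> C * (MAX k\<in>{..<n}. norm (a k)) * (MAX F\<in>Pow {..<n}. norm (\<Sum>k\<in>F. x k)))"

end

theory Submission
  imports Defs
begin

text \<open>
  By duality, the norm of \<open>\<Sum>k. a\<^sub>k x\<^sub>k\<close> is attained by a real functional \<open>g\<close> of norm at most \<open>1\<close>,
  the real part of an \<open>\<bbbF>\<close>-linear functional \<open>f\<close>. Expanding \<open>a\<^sub>k\<close> in the orthonormal basis, the
  Cauchy-Schwarz inequality gives \<open>|f (a\<^sub>k x\<^sub>k)| \<le> \<parallel>a\<^sub>k\<parallel> \<cdot> \<parallel>(f (e\<^sub>n x\<^sub>k))\<^sub>n\<parallel>\<^sub>2\<close>, so that it suffices to bound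
  \<open>\<Sum>k. \<parallel>(f (e\<^sub>n x\<^sub>k))\<^sub>n\<parallel>\<^sub>2\<close> by a constant times the largest norm of a partial sum \<open>\<Sum>k\<in>F. x\<^sub>k\<close>. Up to a
  factor this is Grothendieck's theorem that the inclusion of \<open>\<ell>\<^sub>1\<close> into \<open>\<ell>\<^sub>2\<close> is absolutely summing,
  applied to the vectors \<open>(f (e\<^sub>n x\<^sub>k))\<^sub>n\<close> of \<open>\<ell>\<^sub>1\<close>.

  Two facts carry the bound. First, weak absolute convergence of \<open>\<Sum>n. e\<^sub>n x\<close> says that for every \<open>x\<close>
  the signed partial sums \<open>\<Sum>n<N. \<plusminus> e\<^sub>n x\<close> form a weakly bounded set; the uniform boundedness principle,
  used once in the dual of \<open>Y\<close> and once in \<open>X\<close>, turns this into a bound \<open>K \<parallel>x\<parallel>\<close> that is uniform in the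
  signs, in \<open>N\<close> and in \<open>x\<close> (\<open>signed_partial_sums_bounded\<close>). Secondly, Khinchine's inequality bounds each
  \<open>\<ell>\<^sub>2\<close> norm by twice the average over all signs of \<open>|\<Sum>n<N. \<plusminus> g (e\<^sub>n x\<^sub>k)|\<close>. For fixed signs the sum of
  these absolute values over \<open>k\<close> is a difference of two values of the form
  \<open>g (\<Sum>n<N. \<plusminus> e\<^sub>n (\<Sum>k\<in>P. x\<^sub>k))\<close>, each of which is controlled by \<open>K\<close> and the partial sums of the \<open>x\<^sub>k\<close>
  (\<open>Littlewood_mixed_norm\<close>).

  Functionals and signs are treated over the reals throughout; the field \<open>\<bbbF>\<close> enters only when \<open>f\<close> is
  rebuilt from its real part \<open>g\<close> and when \<open>a\<^sub>k\<close> is expanded. The resulting constant is \<open>8 K\<close>.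
\<close>

section \<open>Norming functionals\<close>

definition sublinear :: "('a::real_vector \<Rightarrow> real) \<Rightarrow> bool" where
  "sublinear p \<longleftrightarrow> (\<forall>x y. p (x + y) \<le> p x + p y) \<and> (\<forall>t\<ge>0. \<forall>x. p (t *\<^sub>R x) \<le> t * p x)"

lemma sublinear_add: "sublinear p \<Longrightarrow> p (x + y) \<le> p x + p y"
  and sublinear_scale_le: "sublinear p \<Longrightarrow> t \<ge> 0 \<Longrightarrow> p (t *\<^sub>R x) \<le> t * p x"
  by (auto simp: sublinear_def)

lemma sublinear_zero: "sublinear p \<Longrightarrow> p 0 = 0"
  using sublinear_add[of p 0 0] sublinear_scale_le[of p 0 0] by simp

text \<open>
  Only the inequality for scalar factors is part of \<open>sublinear\<close>, because it passes to infima without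
  effort; the inequality for the inverse factor gives equality.
\<close>

lemma sublinear_scale:
  assumes "sublinear p" "t \<ge> 0"
  shows "p (t *\<^sub>R x) = t * p x"
proof (cases "t = 0")
  case False
  with assms have "p (inverse t *\<^sub>R t *\<^sub>R x) \<le> inverse t * p (t *\<^sub>R x)"
    by (intro sublinear_scale_le) auto
  with False assms have "t * p x \<le> p (t *\<^sub>R x)"
    by (simp add: field_simps)
  then show ?thesis
    using sublinear_scale_le[OF assms] by (simp add: antisym)
qed (use assms in \<open>simp add: sublinear_zero\<close>)

lemma sublinear_ge_minus: "sublinear p \<Longrightarrow> - p (- x) \<le> p x"
  using sublinear_add[of p x "- x"] sublinear_zero[of p] by simp

lemma sublinear_norm: "sublinear norm"
  by (simp add: sublinear_def norm_triangle_ineq)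

text \<open>
  The infimum of \<open>p\<close> along the ray in direction \<open>y\<close>, corrected by the growth of \<open>p\<close> on that ray. It is
  the largest sublinear minorant of \<open>p\<close> that takes the value \<open>- p y\<close> at \<open>- y\<close>, so passing from \<open>p\<close> to
  \<open>shear p y\<close> makes the functional linear along \<open>y\<close>.
\<close>

definition shear :: "('a::real_vector \<Rightarrow> real) \<Rightarrow> 'a \<Rightarrow> 'a \<Rightarrow> real" where
  "shear p y x = (INF t\<in>{0..}. p (x + t *\<^sub>R y) - t * p y)"

context
  fixes p :: "'a::real_vector \<Rightarrow> real" and y :: 'a
  assumes p: "sublinear p"
begin

lemma shear_le:
  assumes "t \<ge> 0"
  shows "shear p y x \<le> p (x + t *\<^sub>R y) - t * p y"
  unfolding shear_def
proof (rule cINF_lower)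
  show "bdd_below ((\<lambda>t. p (x + t *\<^sub>R y) - t * p y) ` {0..})"
  proof (intro bdd_belowI2)
    fix t :: real
    assume "t \<in> {0..}"
    then show "- p (- x) \<le> p (x + t *\<^sub>R y) - t * p y"
      using sublinear_add[OF p, of "x + t *\<^sub>R y" "- x"] sublinear_scale[OF p, of t y] by simp
  qed
qed (use assms in simp)

lemma le_shear:
  assumes "\<And>t. t \<ge> 0 \<Longrightarrow> b \<le> p (x + t *\<^sub>R y) - t * p y"
  shows "b \<le> shear p y x"
  unfolding shear_def by (rule cINF_greatest) (use assms in auto)

lemma sublinear_shear: "sublinear (shear p y)"
  unfolding sublinear_def
proof (intro conjI allI impI)
  fix u v
  have *: "shear p y (u + v) \<le> (p (u + s *\<^sub>R y) - s * p y) + (p (v + t *\<^sub>R y) - t * p y)"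
    if "s \<ge> 0" "t \<ge> 0" for s t
  proof -
    have "shear p y (u + v) \<le> p ((u + v) + (s + t) *\<^sub>R y) - (s + t) * p y"
      using that by (intro shear_le) auto
    moreover have "p ((u + v) + (s + t) *\<^sub>R y) \<le> p (u + s *\<^sub>R y) + p (v + t *\<^sub>R y)"
      using sublinear_add[OF p, of "u + s *\<^sub>R y" "v + t *\<^sub>R y"] by (simp add: algebra_simps)
    ultimately show ?thesis
      by (simp add: algebra_simps)
  qed
  have "shear p y (u + v) - shear p y v \<le> p (u + s *\<^sub>R y) - s * p y" if "s \<ge> 0" for s
  proof -
    have "shear p y (u + v) - (p (u + s *\<^sub>R y) - s * p y) \<le> shear p y v"
      by (rule le_shear) (use *[OF that] in \<open>force simp: algebra_simps\<close>)
    then show ?thesis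
      by simp
  qed
  from le_shear[OF this] show "shear p y (u + v) \<le> shear p y u + shear p y v"
    by simp
next
  fix t :: real and u
  assume "t \<ge> 0"
  show "shear p y (t *\<^sub>R u) \<le> t * shear p y u"
  proof (cases "t = 0")
    case True
    then show ?thesis
      using shear_le[of 0 0] sublinear_zero[OF p] by simp
  next
    case False
    with \<open>t \<ge> 0\<close> have "t > 0" by simp
    have "shear p y (t *\<^sub>R u) / t \<le> p (u + s *\<^sub>R y) - s * p y" if "s \<ge> 0" for s
    proof -
      have "shear p y (t *\<^sub>R u) \<le> p (t *\<^sub>R u + (t * s) *\<^sub>R y) - (t * s) * p y"
        using that \<open>t > 0\<close> by (intro shear_le) auto
      also have "\<dots> = t * (p (u + s *\<^sub>R y) - s * p y)"
        using sublinear_scale[OF p, of t "u + s *\<^sub>R y"] \<open>t > 0\<close> by (simp add: algebra_simps)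
      finally show ?thesis
        using \<open>t > 0\<close> by (simp add: field_simps)
    qed
    from le_shear[OF this] show ?thesis
      using \<open>t > 0\<close> by (simp add: field_simps)
  qed
qed

end

text \<open>
  Zorn's lemma yields a minimal sublinear \<open>m \<le> p\<close>, and minimal sublinear functionals are linear:
  minimality forces \<open>shear m y = m\<close> for all \<open>y\<close>, and evaluating the shear at \<open>t = 1\<close> turns
  subadditivity of \<open>m\<close> into additivity. Working with functionals on the whole space, there is no
  extension from subspaces to organise.
\<close>

lemma Hahn_Banach_sublinear:
  fixes p :: "'a::real_vector \<Rightarrow> real"
  assumes p: "sublinear p"
  obtains g where "linear g" "\<And>x. g x \<le> p x"
proof -
  define S where "S = {q. sublinear q \<and> q \<le> p}"
  have S: "sublinear q" "q x \<le> p x" "- p (- x) \<le> q x" if "q \<in> S" for q x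
  proof -
    show "sublinear q" and "q x \<le> p x"
      using that by (auto simp: S_def le_fun_def)
    have "q (- x) \<le> p (- x)"
      using that by (auto simp: S_def le_fun_def)
    then show "- p (- x) \<le> q x"
      using sublinear_ge_minus[OF \<open>sublinear q\<close>, of x] by simp
  qed
  have "\<exists>m\<in>S. \<forall>q\<in>S. q \<le> m \<longrightarrow> q = m"
  proof (rule predicate_Zorn)
    show "partial_order_on S (relation_of (\<lambda>q r. r \<le> q) S)"
      by (auto simp: partial_order_on_def preorder_on_def refl_on_def trans_def antisym_def
          relation_of_def)
    fix C
    assume C: "C \<in> Chains (relation_of (\<lambda>q r. r \<le> q) S)"
    then have CS: "C \<subseteq> S"
      by (auto simp: Chains_def relation_of_def)
    have chain: "q \<le> r \<or> r \<le> q" if "q \<in> C" "r \<in> C" for q r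
      using C that by (auto simp: Chains_def relation_of_def)
    show "\<exists>u\<in>S. \<forall>q\<in>C. u \<le> q"
    proof (cases "C = {}")
      case True
      then show ?thesis
        using p by (auto simp: S_def)
    next
      case False
      define i where "i = (\<lambda>x. INF q\<in>C. q x)"
      have i_le: "i x \<le> q x" if "q \<in> C" for q x
        unfolding i_def
        by (rule cINF_lower) (use that CS S(3) in \<open>auto intro!: bdd_belowI2\<close>)
      have le_i: "b \<le> i x" if "\<And>q. q \<in> C \<Longrightarrow> b \<le> q x" for b x
        unfolding i_def by (rule cINF_greatest) (use that False in auto)
      have "sublinear i"
        unfolding sublinear_def
      proof (intro conjI allI impI)
        fix x y
        have *: "i (x + y) \<le> q x + r y" if qr: "q \<in> C" "r \<in> C" for q r
        proof -
          \<comment> \<open>The smaller of \<open>q\<close> and \<open>r\<close> lies below both, which is where the chain condition is used.\<close>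
          have "\<exists>m\<in>C. m x \<le> q x \<and> m y \<le> r y"
            using chain[OF qr] qr by (auto simp: le_fun_def)
          then obtain m where m: "m \<in> C" "m x \<le> q x" "m y \<le> r y"
            by blast
          have "i (x + y) \<le> m x + m y"
            using i_le[OF m(1), of "x + y"] sublinear_add[OF S(1), of m x y] m(1) CS by force
          with m show ?thesis by simp
        qed
        have "i (x + y) - i y \<le> q x" if "q \<in> C" for q
        proof -
          have "i (x + y) - q x \<le> i y"
            by (rule le_i) (use *[OF that] in \<open>force simp: algebra_simps\<close>)
          then show ?thesis by simp
        qed
        then have "i (x + y) - i y \<le> i x"
          by (rule le_i)
        then show "i (x + y) \<le> i x + i y"
          by simp
      next
        fix t :: real and x
        assume "t \<ge> 0"
        obtain q0 where q0: "q0 \<in> C"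
          using False by blast
        show "i (t *\<^sub>R x) \<le> t * i x"
        proof (cases "t = 0")
          case True
          then show ?thesis
            using i_le[OF q0, of 0] sublinear_zero[OF S(1), of q0] q0 CS by auto
        next
          case False
          with \<open>t \<ge> 0\<close> have "t > 0" by simp
          have "i (t *\<^sub>R x) / t \<le> q x" if "q \<in> C" for q
          proof -
            have "i (t *\<^sub>R x) \<le> t * q x"
              using i_le[OF that, of "t *\<^sub>R x"] sublinear_scale_le[OF S(1) \<open>t \<ge> 0\<close>, of q x] that CS
              by force
            with \<open>t > 0\<close> show ?thesis by (simp add: field_simps)
          qed
          from le_i[OF this] show ?thesis
            using \<open>t > 0\<close> by (simp add: field_simps)
        qed
      qed
      moreover have "i \<le> p"
      proof (rule le_funI)
        fix x
        obtain q where "q \<in> C"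
          using False by blast
        then show "i x \<le> p x"
          using i_le[of q x] S(2)[of q x] CS by auto
      qed
      ultimately show ?thesis
        using i_le by (auto simp: S_def le_fun_def)
    qed
  qed
  then obtain m where m: "m \<in> S" and min: "\<And>q. q \<in> S \<Longrightarrow> q \<le> m \<Longrightarrow> q = m"
    by blast
  have sub: "sublinear m"
    using S(1)[OF m] .
  have "shear m y = m" for y
  proof (rule min)
    show le: "shear m y \<le> m"
      using shear_le[OF sub, of 0 y] by (auto simp: le_fun_def)
    show "shear m y \<in> S"
      using sublinear_shear[OF sub, of y] le m by (auto simp: S_def intro: order_trans)
  qed
  then have add: "m (x + y) = m x + m y" for x y
    using shear_le[OF sub, of 1 y x] sublinear_add[OF sub, of x y] by simp
  then have minus: "m (- x) = - m x" for x
    using add[of x "- x"] sublinear_zero[OF sub] by simp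
  have "m (t *\<^sub>R x) = t * m x" for t x
  proof (cases "t \<ge> 0")
    case False
    then show ?thesis
      using sublinear_scale[OF sub, of "- t" x] minus[of "t *\<^sub>R x"] by simp
  qed (rule sublinear_scale[OF sub])
  with add have "linear m"
    by (intro linearI) auto
  with S(2)[OF m] show thesis
    by (intro that[of m])
qed

text \<open>
  A linear minorant of \<open>norm\<close> need not see \<open>y\<close>. A linear minorant of the norm sheared along \<open>y\<close> does,
  since the shear already has the value \<open>- norm y\<close> at \<open>- y\<close>.
\<close>

lemma norming_functional:
  fixes y :: "'a::real_normed_vector"
  obtains g where "linear g" "\<And>x. \<bar>g x\<bar> \<le> norm x" "g y = norm y"
proof -
  obtain g where g: "linear g" "\<And>x. g x \<le> shear norm y x"
    using Hahn_Banach_sublinear[OF sublinear_shear[OF sublinear_norm, of y]] by blast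
  have le: "g x \<le> norm x" for x
    using g(2)[of x] shear_le[OF sublinear_norm, of 0 y x] by simp
  have abs: "\<bar>g x\<bar> \<le> norm x" for x
    using le[of x] le[of "- x"] linear_neg[OF g(1), of x] by simp
  have "- g y \<le> - norm y"
    using g(2)[of "- y"] shear_le[OF sublinear_norm, of 1 y "- y"] linear_neg[OF g(1), of y] by simp
  with le[of y] have "g y = norm y"
    by simp
  with g(1) abs show thesis
    by (intro that[of g])
qed

section \<open>Uniform boundedness\<close>

text \<open>
  The Banach-Steinhaus theorem: by Baire's theorem one of the closed sets on which all \<open>T i\<close> are
  bounded by \<open>n\<close> contains a ball, and a vector of norm \<open>r / 2\<close> is a difference of two points of it.
\<close>

lemma uniform_boundedness:
  fixes T :: "'i \<Rightarrow> 'a::banach \<Rightarrow> 'b::real_normed_vector"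
  assumes lin: "\<And>i. bounded_linear (T i)"
    and pointwise: "\<And>x. \<exists>B. \<forall>i. norm (T i x) \<le> B"
  obtains K where "K > 0" "\<And>i x. norm (T i x) \<le> K * norm x"
proof -
  define E where "E n = {x. \<forall>i. norm (T i x) \<le> real n}" for n
  have closed: "closed (E n)" for n
  proof -
    have "closed {x. norm (T i x) \<le> real n}" for i
      by (intro closed_Collect_le continuous_intros linear_continuous_on lin)
    then show ?thesis
      unfolding E_def by (intro closed_Collect_all)
  qed
  have "\<exists>n. x \<in> E n" for x
  proof -
    obtain B where "\<And>i. norm (T i x) \<le> B"
      using pointwise by blast
    then show ?thesis
      by (auto simp: E_def intro!: exI[of _ "nat \<lceil>B\<rceil>"] intro: order_trans real_nat_ceiling_ge)
  qed
  then have "\<Union> (range E) = UNIV"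
    by auto
  then have "\<exists>n. interior (E n) \<noteq> {}"
    using Met_TC.metric_Baire_category_alt[where ?'a='a, of "range E"] closed complete_UNIV
    by fastforce
  then obtain n x r where r: "r > 0" and ball: "ball x r \<subseteq> E n"
    by (metis ex_in_conv mem_interior)
  have "norm (T i u) \<le> (4 * real n / r + 1) * norm u" for i u
  proof (cases "u = 0")
    case True
    then show ?thesis
      using lin[of i] by (simp add: linear_simps)
  next
    case False
    define v where "v = (r / (2 * norm u)) *\<^sub>R u"
    have "norm v = r / 2"
      using r False by (simp add: v_def)
    then have "x \<in> E n" "x + v \<in> E n"
      using r ball by (auto simp: subset_iff dist_norm)
    then have "norm (T i (x + v)) \<le> real n" "norm (T i x) \<le> real n"
      by (auto simp: E_def)
    moreover have "norm (T i v) \<le> norm (T i (x + v)) + norm (T i x)"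
      using norm_triangle_ineq4[of "T i (x + v)" "T i x"] lin[of i] by (simp add: linear_simps)
    ultimately have "norm (T i v) \<le> 2 * real n"
      by simp
    moreover have "norm (T i v) = r / (2 * norm u) * norm (T i u)"
      unfolding v_def using lin[of i] r by (simp add: linear_simps)
    ultimately have "norm (T i u) \<le> 4 * real n / r * norm u"
      using r False by (simp add: field_simps)
    then show ?thesis
      by (simp add: distrib_right add_increasing2)
  qed
  then show thesis
    using r by (intro that[of "4 * real n / r + 1"]) (auto intro: add_nonneg_pos)
qed

section \<open>Inequalities for random signs\<close>

definition signs :: "nat set \<Rightarrow> nat \<Rightarrow> real" where
  "signs D n = (if n \<in> D then 1 else - 1)"

text \<open>
  Sums over the subsets of \<open>{..<N}\<close> play the role of expectations of independent random signs,
  multiplied by \<open>2 ^ N\<close>; this equation conditions on all signs but the last one.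
\<close>

lemma sum_Pow_lessThan_Suc:
  fixes \<phi> :: "nat set \<Rightarrow> 'a::comm_monoid_add"
  shows "(\<Sum>D\<in>Pow {..<Suc N}. \<phi> D) = (\<Sum>D\<in>Pow {..<N}. \<phi> D + \<phi> (insert N D))"
proof -
  have "inj_on (insert N) (Pow {..<N})"
    by (auto simp: inj_on_def insert_eq_iff)
  moreover have "Pow {..<N} \<inter> insert N ` Pow {..<N} = {}"
    by auto
  ultimately show ?thesis
    by (simp add: lessThan_Suc Pow_insert sum.union_disjoint sum.reindex sum.distrib)
qed

context
  fixes t :: "nat \<Rightarrow> real"
begin

definition signed_sum :: "nat \<Rightarrow> nat set \<Rightarrow> real" where
  "signed_sum N D = (\<Sum>n<N. signs D n * t n)"

lemma signed_sum_Suc: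
  assumes "D \<subseteq> {..<N}"
  shows "signed_sum (Suc N) D = signed_sum N D - t N"
    and "signed_sum (Suc N) (insert N D) = signed_sum N D + t N"
proof -
  have "(\<Sum>n<N. signs (insert N D) n * t n) = (\<Sum>n<N. signs D n * t n)"
    by (rule sum.cong) (auto simp: signs_def)
  then show "signed_sum (Suc N) (insert N D) = signed_sum N D + t N"
    by (simp add: signed_sum_def signs_def)
  show "signed_sum (Suc N) D = signed_sum N D - t N"
    using assms by (auto simp: signed_sum_def signs_def)
qed

lemma signed_sum_second_moment:
  "(\<Sum>D\<in>Pow {..<N}. (signed_sum N D)\<^sup>2) = 2 ^ N * (\<Sum>n<N. (t n)\<^sup>2)"
proof (induction N)
  case 0
  then show ?case by (simp add: signed_sum_def)
next
  case (Suc N)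
  have "(\<Sum>D\<in>Pow {..<Suc N}. (signed_sum (Suc N) D)\<^sup>2)
      = (\<Sum>D\<in>Pow {..<N}. 2 * (signed_sum N D)\<^sup>2 + 2 * (t N)\<^sup>2)"
    unfolding sum_Pow_lessThan_Suc
    by (rule sum.cong) (auto simp: signed_sum_Suc power2_eq_square algebra_simps)
  also have "\<dots> = 2 * (2 ^ N * (\<Sum>n<N. (t n)\<^sup>2)) + 2 ^ N * (2 * (t N)\<^sup>2)"
    by (simp add: sum.distrib card_Pow flip: sum_distrib_left Suc.IH)
  finally show ?case
    by (simp add: algebra_simps)
qed

lemma signed_sum_fourth_moment:
  "(\<Sum>D\<in>Pow {..<N}. (signed_sum N D) ^ 4) \<le> 3 * 2 ^ N * (\<Sum>n<N. (t n)\<^sup>2)\<^sup>2"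
proof (induction N)
  case 0
  then show ?case by (simp add: signed_sum_def)
next
  case (Suc N)
  define s where "s = (\<Sum>n<N. (t n)\<^sup>2)"
  have "(\<Sum>D\<in>Pow {..<Suc N}. (signed_sum (Suc N) D) ^ 4)
      = (\<Sum>D\<in>Pow {..<N}. 2 * (signed_sum N D) ^ 4 + 12 * (t N)\<^sup>2 * (signed_sum N D)\<^sup>2 + 2 * (t N) ^ 4)"
    unfolding sum_Pow_lessThan_Suc
    by (rule sum.cong) (auto simp: signed_sum_Suc power2_eq_square power4_eq_xxxx algebra_simps)
  also have "\<dots> = 2 * (\<Sum>D\<in>Pow {..<N}. (signed_sum N D) ^ 4)
      + 12 * (t N)\<^sup>2 * (2 ^ N * s) + 2 ^ N * (2 * (t N) ^ 4)"
    by (simp add: sum.distrib card_Pow s_def flip: sum_distrib_left signed_sum_second_moment)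
  also have "\<dots> \<le> 2 * (3 * 2 ^ N * s\<^sup>2) + 12 * (t N)\<^sup>2 * (2 ^ N * s) + 2 ^ N * (2 * (t N) ^ 4)"
    using Suc.IH by (simp add: s_def)
  also have "\<dots> \<le> 3 * 2 ^ Suc N * (s + (t N)\<^sup>2)\<^sup>2"
  proof -
    have "0 \<le> 2 ^ N * (t N) ^ 4"
      by simp
    then show ?thesis
      by (simp add: power2_eq_square power4_eq_xxxx algebra_simps)
  qed
  finally show ?case
    by (simp add: s_def)
qed

text \<open>
  The lower bound on the first absolute moment comes from the second and fourth moments. A polynomial
  minorant \<open>u\<^sup>2 - (4 / 27) u\<^sup>4 \<le> \<bar>u\<bar>\<close> replaces Hoelder's inequality. The coefficient \<open>4 / 27\<close> is the
  smallest one for which it holds, as then \<open>u - (4 / 27) u\<^sup>3\<close> has the maximum \<open>1\<close> on the positive axis,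
  at \<open>u = 3 / 2\<close>. For coefficients of Euclidean norm \<open>1\<close> the minorant has expectation at least
  \<open>1 - 3 \<cdot> (4 / 27) = 5 / 9\<close>, which exceeds \<open>1 / 2\<close>.
\<close>

lemma Khinchine:
  "2 ^ N * L2_set t {..<N} \<le> 2 * (\<Sum>D\<in>Pow {..<N}. \<bar>\<Sum>n<N. signs D n * t n\<bar>)"
proof (cases "L2_set t {..<N} = 0")
  case True
  then show ?thesis
    by (simp add: sum_nonneg)
next
  case False
  define r where "r = L2_set t {..<N}"
  have r: "r > 0"
    using False L2_set_nonneg[of t "{..<N}"] by (simp add: r_def less_le)
  have r2: "(\<Sum>n<N. (t n)\<^sup>2) = r\<^sup>2"
    by (simp add: r_def L2_set_def sum_nonneg)
  \<comment> \<open>The minorant for coefficients of norm \<open>r\<close>, made homogeneous and multiplied by \<open>27 r\<^sup>4\<close>.\<close>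
  have pw: "27 * r\<^sup>2 * u\<^sup>2 - 4 * u ^ 4 \<le> 27 * r ^ 3 * \<bar>u\<bar>" for u
  proof -
    have "0 \<le> \<bar>u\<bar> * ((2 * \<bar>u\<bar> - 3 * r)\<^sup>2 * (\<bar>u\<bar> + 3 * r))"
      using r by simp
    also have "\<dots> = 27 * r ^ 3 * \<bar>u\<bar> - 27 * r\<^sup>2 * \<bar>u\<bar>\<^sup>2 + 4 * \<bar>u\<bar> ^ 4"
      by (simp add: power2_eq_square power3_eq_cube power4_eq_xxxx algebra_simps)
    finally show ?thesis
      by (simp add: power_even_abs)
  qed
  have "2 ^ N * (15 * r ^ 4) \<le> 27 * r\<^sup>2 * (2 ^ N * r\<^sup>2) - 4 * (3 * 2 ^ N * (r\<^sup>2)\<^sup>2)"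
    by (simp add: power2_eq_square power4_eq_xxxx)
  also have "\<dots> \<le> 27 * r\<^sup>2 * (\<Sum>D\<in>Pow {..<N}. (signed_sum N D)\<^sup>2)
      - 4 * (\<Sum>D\<in>Pow {..<N}. (signed_sum N D) ^ 4)"
    using signed_sum_second_moment[of N] signed_sum_fourth_moment[of N] by (simp add: r2)
  also have "\<dots> = (\<Sum>D\<in>Pow {..<N}. 27 * r\<^sup>2 * (signed_sum N D)\<^sup>2 - 4 * (signed_sum N D) ^ 4)"
    by (simp add: sum_subtractf sum_distrib_left)
  also have "\<dots> \<le> (\<Sum>D\<in>Pow {..<N}. 27 * r ^ 3 * \<bar>signed_sum N D\<bar>)"
    by (intro sum_mono pw)
  also have "\<dots> = r ^ 3 * (27 * (\<Sum>D\<in>Pow {..<N}. \<bar>signed_sum N D\<bar>))"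
    by (simp add: sum_distrib_left mult_ac)
  finally have "r ^ 3 * (15 * (2 ^ N * r)) \<le> r ^ 3 * (27 * (\<Sum>D\<in>Pow {..<N}. \<bar>signed_sum N D\<bar>))"
    by (simp add: power3_eq_cube power4_eq_xxxx mult_ac)
  then have "15 * (2 ^ N * r) \<le> 27 * (\<Sum>D\<in>Pow {..<N}. \<bar>signed_sum N D\<bar>)"
    using r by simp
  moreover have "0 \<le> (\<Sum>D\<in>Pow {..<N}. \<bar>signed_sum N D\<bar>)"
    by (simp add: sum_nonneg)
  ultimately have "2 ^ N * r \<le> 2 * (\<Sum>D\<in>Pow {..<N}. \<bar>signed_sum N D\<bar>)"
    by linarith
  then show ?thesis
    by (simp add: signed_sum_def r_def)
qed

end

text \<open>
  The terms of either sign are collected, and on each of the two parts \<open>g\<close> commutes with the sum.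
\<close>

lemma sum_abs_functional_le:
  fixes x :: "'i \<Rightarrow> 'a::real_vector"
  assumes "linear g" "finite A"
    and bound: "\<And>P. P \<subseteq> A \<Longrightarrow> \<bar>g (\<Sum>k\<in>P. x k)\<bar> \<le> B"
  shows "(\<Sum>k\<in>A. \<bar>g (x k)\<bar>) \<le> 2 * (B::real)"
proof -
  define P where "P = {k \<in> A. g (x k) \<ge> 0}"
  have "(\<Sum>k\<in>A. \<bar>g (x k)\<bar>) = (\<Sum>k\<in>P. \<bar>g (x k)\<bar>) + (\<Sum>k\<in>A - P. \<bar>g (x k)\<bar>)"
    using assms(2) by (subst sum.subset_diff[of P]) (auto simp: P_def)
  also have "(\<Sum>k\<in>P. \<bar>g (x k)\<bar>) = (\<Sum>k\<in>P. g (x k))"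
    by (rule sum.cong) (auto simp: P_def)
  also have "(\<Sum>k\<in>A - P. \<bar>g (x k)\<bar>) = (\<Sum>k\<in>A - P. - g (x k))"
    by (rule sum.cong) (auto simp: P_def)
  also have "(\<Sum>k\<in>P. g (x k)) + (\<Sum>k\<in>A - P. - g (x k)) = g (\<Sum>k\<in>P. x k) - g (\<Sum>k\<in>A - P. x k)"
    using \<open>linear g\<close> by (simp add: linear_sum sum_negf)
  also have "\<dots> \<le> 2 * B"
    using bound[of P] bound[of "A - P"] by (auto simp: P_def)
  finally show ?thesis .
qed

text \<open>
  Littlewood's mixed inequality for the matrix \<open>g (T n (x k))\<close>. Khinchine's inequality is applied in
  the index \<open>n\<close>, for each \<open>k\<close> separately; after interchanging the sums, the remaining sum over \<open>k\<close>
  concerns fixed signs \<open>D\<close>, where \<open>\<Sum>n<N. signs D n *\<^sub>R T n x\<close> is a single linear function of \<open>x\<close>.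
\<close>

lemma Littlewood_mixed_norm:
  fixes T :: "nat \<Rightarrow> 'a::real_normed_vector \<Rightarrow> 'b::real_normed_vector" and x :: "'i \<Rightarrow> 'a"
  assumes lin: "\<And>n. linear (T n)"
    and signed: "\<And>D x. norm (\<Sum>n<N. signs D n *\<^sub>R T n x) \<le> K * norm x"
    and "K \<ge> 0"
    and g: "linear g" "\<And>y. \<bar>g y\<bar> \<le> norm y"
    and "finite A"
    and L: "\<And>P. P \<subseteq> A \<Longrightarrow> norm (\<Sum>k\<in>P. x k) \<le> L"
  shows "(\<Sum>k\<in>A. L2_set (\<lambda>n. g (T n (x k))) {..<N}) \<le> 4 * K * L"
proof -
  have one: "(\<Sum>k\<in>A. \<bar>\<Sum>n<N. signs D n * g (T n (x k))\<bar>) \<le> 2 * (K * L)" for D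
  proof -
    define h where "h = (\<lambda>x. g (\<Sum>n<N. signs D n *\<^sub>R T n x))"
    have "linear h"
      unfolding h_def
      by (intro linear_compose[OF _ g(1), unfolded o_def] linear_compose_sum ballI
          linear_compose[OF lin linear_scale_self, unfolded o_def])
    moreover have "\<bar>h (\<Sum>k\<in>P. x k)\<bar> \<le> K * L" if "P \<subseteq> A" for P
      unfolding h_def
      by (rule order_trans[OF g(2)], rule order_trans[OF signed])
        (use that L \<open>K \<ge> 0\<close> in \<open>simp add: mult_left_mono\<close>)
    ultimately have "(\<Sum>k\<in>A. \<bar>h (x k)\<bar>) \<le> 2 * (K * L)"
      using \<open>finite A\<close> by (intro sum_abs_functional_le)
    then show ?thesis
      using g(1) by (simp add: h_def linear_sum linear_scale)
  qed
  have "2 ^ N * (\<Sum>k\<in>A. L2_set (\<lambda>n. g (T n (x k))) {..<N})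
      \<le> (\<Sum>k\<in>A. 2 * (\<Sum>D\<in>Pow {..<N}. \<bar>\<Sum>n<N. signs D n * g (T n (x k))\<bar>))"
    by (subst sum_distrib_left) (intro sum_mono Khinchine)
  also have "\<dots> = 2 * (\<Sum>D\<in>Pow {..<N}. \<Sum>k\<in>A. \<bar>\<Sum>n<N. signs D n * g (T n (x k))\<bar>)"
    by (subst sum.swap) (simp add: sum_distrib_left)
  also have "\<dots> \<le> 2 * (\<Sum>D\<in>Pow {..<N}. 2 * (K * L))"
    by (intro mult_left_mono sum_mono one) auto
  also have "\<dots> = 2 ^ N * (4 * K * L)"
    by (simp add: card_Pow)
  finally show ?thesis
    by simp
qed

section \<open>Weakly absolutely convergent series of operators\<close>

text \<open>
  The points \<open>y i\<close> act on the dual space by evaluation, and weak boundedness is pointwise boundedness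
  of these evaluations. Norming functionals show that evaluation does not shrink the norm.
\<close>

lemma weakly_bounded_imp_bounded:
  fixes y :: "'i \<Rightarrow> 'a::real_normed_vector"
  assumes weak: "\<And>g :: 'a \<Rightarrow> real. bounded_linear g \<Longrightarrow> \<exists>B. \<forall>i. \<bar>g (y i)\<bar> \<le> B"
  shows "\<exists>B. \<forall>i. norm (y i) \<le> B"
proof -
  have "\<exists>K. \<forall>i (g :: 'a \<Rightarrow>\<^sub>L real). norm (blinfun_apply g (y i)) \<le> K * norm g"
  proof (rule uniform_boundedness[of "\<lambda>i (g :: 'a \<Rightarrow>\<^sub>L real). blinfun_apply g (y i)"])
    fix K
    assume "\<And>i (g :: 'a \<Rightarrow>\<^sub>L real). norm (blinfun_apply g (y i)) \<le> K * norm g"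
    then show ?thesis
      by blast
  next
    show "bounded_linear (\<lambda>g :: 'a \<Rightarrow>\<^sub>L real. blinfun_apply g (y i))" for i
      by (rule blinfun.bounded_linear_left)
    show "\<exists>B. \<forall>i. norm (blinfun_apply g (y i)) \<le> B" for g :: "'a \<Rightarrow>\<^sub>L real"
      using weak[OF blinfun.bounded_linear_right[of g]] by simp
  qed
  then obtain K where K: "\<And>i (g :: 'a \<Rightarrow>\<^sub>L real). norm (blinfun_apply g (y i)) \<le> K * norm g"
    by blast
  have "norm (y i) \<le> max K 0" for i
  proof -
    obtain g where g: "linear g" "\<And>x. \<bar>g x\<bar> \<le> norm x" "g (y i) = norm (y i)"
      using norming_functional[of "y i"] by blast
    have "bounded_linear g"
      using g(1,2) by (intro bounded_linear_intro[of g 1]) (auto simp: linear_add linear_scale)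
    then have app: "blinfun_apply (Blinfun g) = g"
      by (rule bounded_linear_Blinfun_apply)
    have "norm (Blinfun g) \<le> 1"
      by (rule norm_blinfun_bound) (use g(2) in \<open>auto simp: app\<close>)
    then have "max K 0 * norm (Blinfun g) \<le> max K 0 * 1"
      by (intro mult_left_mono) auto
    moreover have "norm (y i) \<le> K * norm (Blinfun g)"
      using K[of "Blinfun g" i] g(3) by (simp add: app)
    moreover have "K * norm (Blinfun g) \<le> max K 0 * norm (Blinfun g)"
      by (intro mult_right_mono) auto
    ultimately show ?thesis
      by linarith
  qed
  then show ?thesis
    by blast
qed

text \<open>
  For fixed \<open>x\<close> the series \<open>\<Sum>n. \<bar>g (T n x)\<bar>\<close> bounds \<open>g\<close> on all signed partial sums, which makes
  them weakly bounded and hence bounded; a second application of uniform boundedness, to the signed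
  partial sums as operators, makes the bound linear in \<open>norm x\<close>.
\<close>

lemma signed_partial_sums_bounded:
  fixes T :: "nat \<Rightarrow> 'a::banach \<Rightarrow> 'b::real_normed_vector"
  assumes lin: "\<And>n. bounded_linear (T n)"
    and weak: "\<And>x (g :: 'b \<Rightarrow> real). bounded_linear g \<Longrightarrow> summable (\<lambda>n. \<bar>g (T n x)\<bar>)"
  obtains K where "K > 0"
    "\<And>N D x. norm (\<Sum>n<N. signs D n *\<^sub>R T n x) \<le> K * norm x"
proof -
  define S where "S = (\<lambda>(N, D) x. \<Sum>n<N. signs D n *\<^sub>R T n x)"
  have "\<exists>K>0. \<forall>i x. norm (S i x) \<le> K * norm x"
  proof (rule uniform_boundedness[of S])
    fix K
    assume "K > 0" "\<And>i x. norm (S i x) \<le> K * norm x"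
    then show ?thesis
      by blast
  next
    show "bounded_linear (S i)" for i
      unfolding S_def by (cases i)
        (auto intro!: bounded_linear_sum lin bounded_linear_compose[OF bounded_linear_scaleR_right])
    show "\<exists>B. \<forall>i. norm (S i x) \<le> B" for x
    proof (rule weakly_bounded_imp_bounded)
      fix g :: "'b \<Rightarrow> real"
      assume g: "bounded_linear g"
      have "\<bar>g (\<Sum>n<N. signs D n *\<^sub>R T n x)\<bar> \<le> (\<Sum>n. \<bar>g (T n x)\<bar>)" for N D
      proof -
        have "\<bar>g (\<Sum>n<N. signs D n *\<^sub>R T n x)\<bar> = \<bar>\<Sum>n<N. signs D n * g (T n x)\<bar>"
          using g by (simp add: bounded_linear.linear linear_sum linear_scale)
        also have "\<dots> \<le> (\<Sum>n<N. \<bar>g (T n x)\<bar>)"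
          by (rule order_trans[OF sum_abs], rule sum_mono) (simp add: signs_def abs_mult)
        also have "\<dots> \<le> (\<Sum>n. \<bar>g (T n x)\<bar>)"
          by (intro sum_le_suminf weak g) auto
        finally show ?thesis .
      qed
      then show "\<exists>B. \<forall>i. \<bar>g (S i x)\<bar> \<le> B"
        by (auto simp: S_def)
    qed
  qed
  then obtain K where K: "K > 0" "\<And>i x. norm (S i x) \<le> K * norm x"
    by blast
  show thesis
  proof (rule that[OF K(1)])
    show "norm (\<Sum>n<N. signs D n *\<^sub>R T n x) \<le> K * norm x" for N D x
      using K(2)[of "(N, D)" x] by (simp add: S_def)
  qed
qed

section \<open>Functionals on Banach spaces over the real or complex field\<close>

text \<open>
  Multiplying by the conjugate, the square of the norm is \<open>a\<^sup>2 + b\<^sup>2\<close> over the complex numbers and \<open>a\<^sup>2\<close>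
  over the reals, where \<open>imag_unit\<close> is \<open>0\<close>.
\<close>

lemma abs_le_norm_re_im:
  "\<bar>a\<bar> \<le> norm (a *\<^sub>R 1 + b *\<^sub>R imag_unit :: 'f::real_or_complex)"
proof -
  let ?z = "a *\<^sub>R 1 + b *\<^sub>R imag_unit :: 'f"
  have "(norm ?z)\<^sup>2 *\<^sub>R (1::'f) = ?z * (a *\<^sub>R 1 - b *\<^sub>R imag_unit)"
    by (metis conjugate_re_im mult_conjugate)
  also have "\<dots> = a\<^sup>2 *\<^sub>R 1 - b\<^sup>2 *\<^sub>R (imag_unit * imag_unit)"
    by (simp add: algebra_simps power2_eq_square)
  also have "\<dots> = (if imag_unit * imag_unit = (- 1 :: 'f) then a\<^sup>2 + b\<^sup>2 else a\<^sup>2) *\<^sub>R 1"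
    using imag_unit[where 'a='f] by (auto simp: algebra_simps)
  finally have "(norm ?z)\<^sup>2 = (if imag_unit * imag_unit = (- 1 :: 'f) then a\<^sup>2 + b\<^sup>2 else a\<^sup>2)"
    by (simp add: scaleR_right_imp_eq)
  then have "a\<^sup>2 \<le> (norm ?z)\<^sup>2"
    by (auto split: if_splits)
  then show ?thesis
    using abs_le_square_iff[of a "norm ?z"] by simp
qed

lemma norm_imag_unit_le_1: "norm (imag_unit :: 'f::real_or_complex) \<le> 1"
proof (cases "imag_unit = (0 :: 'f)")
  case False
  then have "norm (imag_unit * imag_unit :: 'f) = 1"
    using imag_unit[where 'a='f] by (metis norm_minus_cancel norm_one)
  then have "(norm (imag_unit :: 'f))\<^sup>2 = 1"
    by (simp add: norm_mult power2_eq_square)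
  then show ?thesis
    by (simp add: power2_eq_1_iff) (metis norm_ge_zero le_minus_one_simps(3) order_refl)
qed simp

context banach_space_over
begin

lemma scale_scaleR: "scale (r *\<^sub>R c) x = r *\<^sub>R scale c x"
  by (metis scale_of_real scale_scale scaleR_conv_of_real)

lemma bounded_linear_scale: "bounded_linear (scale c)"
proof (rule bounded_linear_intro)
  show "scale c (x + y) = scale c x + scale c y" for x y
    by (rule scale_right_distrib)
  show "scale c (r *\<^sub>R x) = r *\<^sub>R scale c x" for r x
    by (metis scale_left_commute scale_of_real)
  show "norm (scale c x) \<le> norm x * norm c" for x
    by (simp add: norm_scale)
qed

text \<open>
  The \<open>\<bbbF>\<close>-linear functional with real part \<open>g\<close>, namely \<open>y \<mapsto> g y - \<i> g (\<i> y)\<close>. Over the reals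
  \<open>imag_unit\<close> vanishes and the formula gives \<open>g\<close> itself, so the two fields need no separate treatment.
\<close>

definition complexify :: "('x \<Rightarrow> real) \<Rightarrow> 'x \<Rightarrow> 'f" where
  "complexify g y = g y *\<^sub>R 1 + (- g (scale imag_unit y)) *\<^sub>R imag_unit"

lemma abs_le_norm_complexify: "\<bar>g y\<bar> \<le> norm (complexify g y)"
  unfolding complexify_def by (rule abs_le_norm_re_im)

lemma norm_complexify_le: "norm (complexify g y) \<le> \<bar>g y\<bar> + \<bar>g (scale imag_unit y)\<bar>"
proof -
  have "norm (complexify g y) \<le> norm (g y *\<^sub>R (1 :: 'f)) + norm ((- g (scale imag_unit y)) *\<^sub>R (imag_unit :: 'f))"
    unfolding complexify_def by (rule norm_triangle_ineq)
  also have "\<dots> \<le> \<bar>g y\<bar> * 1 + \<bar>g (scale imag_unit y)\<bar> * 1"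
    unfolding norm_scaleR abs_minus_cancel
    by (intro add_mono mult_left_mono norm_imag_unit_le_1) auto
  finally show ?thesis
    by simp
qed

lemma linear_complexify:
  assumes "linear g"
  shows "Vector_Spaces.linear scale (*) (complexify g)"
proof -
  interpret g: linear g
    by (rule assms)
  have add: "complexify g (x + y) = complexify g x + complexify g y" for x y
    by (simp add: complexify_def scale_right_distrib g.add algebra_simps)
  have sR: "complexify g (r *\<^sub>R y) = r *\<^sub>R complexify g y" for r y
    using bounded_linear_scale[of imag_unit]
    by (simp add: complexify_def g.scale linear_simps algebra_simps)
  have im: "complexify g (scale imag_unit y) = imag_unit * complexify g y" for y
  proof (cases "imag_unit = (0 :: 'f)")
    case True
    then show ?thesis
      by (simp add: complexify_def g.zero)
  next
    case False
    then have "imag_unit * imag_unit = (- 1 :: 'f)"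
      using imag_unit[where 'a='f] by simp
    then show ?thesis
      by (simp add: complexify_def g.neg algebra_simps)
  qed
  have "complexify g (scale c y) = c * complexify g y" for c y
  proof -
    obtain a b where c: "c = a *\<^sub>R 1 + b *\<^sub>R imag_unit"
      using re_im_decomposition by blast
    have "complexify g (scale c y) = complexify g (a *\<^sub>R y + b *\<^sub>R scale imag_unit y)"
      by (simp add: c scale_left_distrib scale_scaleR)
    then show ?thesis
      by (simp add: add sR im c algebra_simps)
  qed
  with add show ?thesis
    unfolding Vector_Spaces.linear_iff
    using vector_space_axioms vector_space_over_itself.vector_space_axioms by blast
qed

lemma continuous_complexify:
  assumes "bounded_linear g"
  shows "continuous_on UNIV (complexify g)"
  unfolding complexify_def
  by (intro continuous_intros linear_continuous_on assms
      bounded_linear_compose[OF assms bounded_linear_scale])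

end

section \<open>Functionals on Hilbert spaces\<close>

context hilbert_space_over
begin

text \<open>
  In the proof the expansion is required for all large \<open>N\<close> rather than for one, so that two vectors can
  be expanded over a common range of indices when they are added.
\<close>

lemma span_orthonormal_expansion:
  fixes e :: "nat \<Rightarrow> 'x"
  assumes e: "\<And>m n. ip (e m) (e n) = (if m = n then 1 else 0)"
    and "a \<in> span (range e)"
  shows "\<exists>N. a = (\<Sum>n<N. scale (ip a (e n)) (e n))"
proof -
  have ip_zero: "ip 0 z = 0" for z
    using ip_scale[of 0 0 z] by simp
  define expands where "expands a N \<longleftrightarrow> a = (\<Sum>n<N. scale (ip a (e n)) (e n))" for a N
  have "\<exists>N. \<forall>m\<ge>N. expands a m"
    using assms(2)
  proof (induction rule: span_induct)
    case base
    show ?case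
    proof (rule subspaceI)
      show "0 \<in> {a. \<exists>N. \<forall>m\<ge>N. expands a m}"
        by (simp add: expands_def ip_zero)
    next
      fix x y
      assume "x \<in> {a. \<exists>N. \<forall>m\<ge>N. expands a m}" "y \<in> {a. \<exists>N. \<forall>m\<ge>N. expands a m}"
      then obtain M N where MN: "\<And>m. m \<ge> M \<Longrightarrow> expands x m" "\<And>m. m \<ge> N \<Longrightarrow> expands y m"
        by blast
      have "expands (x + y) m" if x: "expands x m" and y: "expands y m" for m
        using arg_cong2[OF x[unfolded expands_def] y[unfolded expands_def], of "(+)"]
        unfolding expands_def ip_add scale_left_distrib sum.distrib .
      with MN have "\<forall>m\<ge>max M N. expands (x + y) m"
        by simp
      then show "x + y \<in> {a. \<exists>N. \<forall>m\<ge>N. expands a m}"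
        by blast
    next
      fix c x
      assume "x \<in> {a. \<exists>N. \<forall>m\<ge>N. expands a m}"
      moreover have "expands (scale c x) m" if x: "expands x m" for m
        using arg_cong[OF x[unfolded expands_def], of "scale c"]
        unfolding expands_def ip_scale scale_sum_right scale_scale .
      ultimately show "scale c x \<in> {a. \<exists>N. \<forall>m\<ge>N. expands a m}"
        by blast
    qed
  next
    case (step a)
    then obtain j where j: "a = e j"
      by blast
    have "expands a m" if "m \<ge> Suc j" for m
    proof -
      have "(\<Sum>n<m. scale (ip a (e n)) (e n)) = (\<Sum>n<m. if j = n then e n else 0)"
        by (rule sum.cong) (auto simp: j e)
      then show ?thesis
        using that by (simp add: expands_def j)
    qed
    then show ?case
      by blast
  qed
  then obtain N where "expands a N"
    by blast
  then show ?thesis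
    unfolding expands_def by (rule exI)
qed

lemma norm_orthonormal_expansion:
  fixes e :: "nat \<Rightarrow> 'x"
  assumes "a = (\<Sum>n<N. scale (ip a (e n)) (e n))"
  shows "norm a = L2_set (\<lambda>n. norm (ip a (e n))) {..<N}"
proof -
  have ip_sum: "ip (\<Sum>n\<in>I. x n) z = (\<Sum>n\<in>I. ip (x n) z)" for I :: "nat set" and x z
    using ip_scale[of 0 0 z] by (induction I rule: infinite_finite_induct) (auto simp: ip_add)
  have "(of_real ((norm a)\<^sup>2) :: 'f) = ip (\<Sum>n<N. scale (ip a (e n)) (e n)) a"
    using ip_self[of a] arg_cong[OF assms, of "\<lambda>b. ip b a"] by simp
  also have "\<dots> = (\<Sum>n<N. ip a (e n) * conjugate (ip a (e n)))"
    unfolding ip_sum ip_scale by (rule sum.cong) (simp_all flip: ip_commute)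
  also have "\<dots> = of_real (\<Sum>n<N. (norm (ip a (e n)))\<^sup>2)"
    by (simp add: mult_conjugate scaleR_conv_of_real)
  finally have "(norm a)\<^sup>2 = (\<Sum>n<N. (norm (ip a (e n)))\<^sup>2)"
    unfolding of_real_eq_iff .
  then show ?thesis
    by (simp add: L2_set_def real_sqrt_unique)
qed

text \<open>
  On the span of the basis this is the Cauchy-Schwarz inequality for the coefficients; both sides are
  continuous in \<open>a\<close>, so that it extends to the closure. The bound \<open>D\<close> must not depend on \<open>N\<close>, since the
  expansions of approximating vectors have unbounded length.
\<close>

lemma norm_linear_functional_le:
  fixes f :: "'x \<Rightarrow> 'f"
  assumes e: "orthonormal_basis e"
    and f: "Vector_Spaces.linear scale (*) f" "continuous_on UNIV f"
    and D: "\<And>N. L2_set (\<lambda>n. norm (f (e n))) {..<N} \<le> D"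
  shows "norm (f a) \<le> norm a * D"
proof -
  interpret f: Vector_Spaces.linear scale "(*)" f
    by (rule f(1))
  have span: "norm (f a) \<le> norm a * D" if a: "a \<in> span (range e)" for a
  proof -
    obtain N where N: "a = (\<Sum>n<N. scale (ip a (e n)) (e n))"
      using span_orthonormal_expansion[OF _ a] e by (auto simp: orthonormal_basis_def)
    have "f a = (\<Sum>n<N. ip a (e n) * f (e n))"
      by (subst N) (simp add: f.sum f.scale)
    then have "norm (f a) \<le> (\<Sum>n<N. \<bar>norm (ip a (e n))\<bar> * \<bar>norm (f (e n))\<bar>)"
      by (simp add: sum_norm_le norm_mult)
    also have "\<dots> \<le> norm a * L2_set (\<lambda>n. norm (f (e n))) {..<N}"
      unfolding norm_orthonormal_expansion[OF N] by (rule L2_set_mult_ineq)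
    also have "\<dots> \<le> norm a * D"
      by (intro mult_left_mono D) auto
    finally show ?thesis .
  qed
  have "closed {a. norm (f a) \<le> norm a * D}"
    by (intro closed_Collect_le continuous_intros f(2))
  then have "closure (span (range e)) \<subseteq> {a. norm (f a) \<le> norm a * D}"
    using span by (intro closure_minimal) auto
  moreover have "a \<in> closure (span (range e))"
    using e by (simp add: orthonormal_basis_def)
  ultimately show ?thesis
    by blast
qed

end

section \<open>Unconditionality of the action\<close>

text \<open>
  The limits serve as bounds \<open>D k\<close> that are independent of \<open>N\<close>, as needed to pass from finite expansions
  to arbitrary vectors of the Hilbert space, while the bound on their sum survives.
\<close>

lemma sum_of_bounded_monotone_limits:
  fixes u :: "'i \<Rightarrow> nat \<Rightarrow> real"
  assumes "finite A" and nonneg: "\<And>k N. 0 \<le> u k N" and mono: "\<And>k. incseq (u k)"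
    and bound: "\<And>N. (\<Sum>k\<in>A. u k N) \<le> B"
  obtains D where "\<And>k N. k \<in> A \<Longrightarrow> u k N \<le> D k" "(\<Sum>k\<in>A. D k) \<le> B"
proof -
  have "\<exists>d. u k \<longlonglongrightarrow> d \<and> (\<forall>N. u k N \<le> d)" if "k \<in> A" for k
  proof -
    have "u k N \<le> B" for N
      by (rule order_trans[OF member_le_sum bound]) (use that assms(1) nonneg in auto)
    then show ?thesis
      using incseq_convergent[OF mono, of k B] by blast
  qed
  then have "\<forall>k\<in>A. \<exists>d. u k \<longlonglongrightarrow> d \<and> (\<forall>N. u k N \<le> d)"
    by blast
  from bchoice[OF this] obtain D
    where D: "\<And>k. k \<in> A \<Longrightarrow> u k \<longlonglongrightarrow> D k" "\<And>k N. k \<in> A \<Longrightarrow> u k N \<le> D k"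
    by blast
  have "(\<lambda>N. \<Sum>k\<in>A. u k N) \<longlonglongrightarrow> (\<Sum>k\<in>A. D k)"
    by (intro tendsto_sum D(1))
  then have "(\<Sum>k\<in>A. D k) \<le> B"
    by (rule LIMSEQ_le_const2) (use bound in auto)
  with D(2) show thesis
    by (rule that)
qed

lemma linear_continuous_imp_bounded_linear:
  fixes f :: "'a::real_normed_vector \<Rightarrow> 'b::real_normed_vector"
  assumes "linear f" "continuous_on UNIV f"
  shows "bounded_linear f"
proof -
  have "isCont f 0"
    using assms(2) by (simp add: continuous_on_eq_continuous_at)
  then obtain d where d: "d > 0" "\<And>x. norm x < d \<Longrightarrow> norm (f x) < 1"
    using linear_0[OF assms(1)] unfolding continuous_at_eps_delta
    by (metis diff_zero dist_norm zero_less_one)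
  have "norm (f x) \<le> norm x * (2 / d)" for x
  proof (cases "x = 0")
    case False
    have "norm (f ((d / (2 * norm x)) *\<^sub>R x)) < 1"
      using d(1) False by (intro d(2)) simp
    with d(1) False show ?thesis
      by (simp add: linear_scale[OF assms(1)] field_simps)
  qed (simp add: linear_0[OF assms(1)])
  with assms(1) show ?thesis
    unfolding bounded_linear_def bounded_linear_axioms_def by blast
qed

context banach_action
begin

lemma bounded_linear_act_right: "bounded_linear (act a)"
proof (rule linear_continuous_imp_bounded_linear)
  interpret L: Vector_Spaces.linear scaleX scaleY "act a"
    by (rule linear_right)
  show "linear (act a)"
    by (rule linearI) (simp_all add: L.add flip: X.scale_of_real Y.scale_of_real L.scale)
  show "continuous_on UNIV (act a)"
    using continuous_on_compose2[OF continuous_act, of UNIV "\<lambda>x. (a, x)"]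
    by (simp add: continuous_on_Pair)
qed

lemma continuous_act_left: "continuous_on UNIV (\<lambda>a. act a x)"
  using continuous_on_compose2[OF continuous_act, of UNIV "\<lambda>a. (a, x)"]
  by (simp add: continuous_on_Pair)

end

theorem theorem5p1:
  fixes scaleA :: "'f::real_or_complex \<Rightarrow> 'a::banach \<Rightarrow> 'a"
    and scaleX :: "'f \<Rightarrow> 'x::banach \<Rightarrow> 'x"
    and scaleY :: "'f \<Rightarrow> 'y::banach \<Rightarrow> 'y"
    and act :: "'a \<Rightarrow> 'x \<Rightarrow> 'y"
    and ip :: "'a \<Rightarrow> 'a \<Rightarrow> 'f"
    and e :: "nat \<Rightarrow> 'a"
  assumes "banach_action scaleA scaleX scaleY act"
    and "hilbert_space_over scaleA ip"
    and "hilbert_space_over.orthonormal_basis scaleA ip e"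
    and "\<And>x. weakly_absolutely_convergent scaleY (\<lambda>n. act (e n) x)"
  shows "unconditional_action act"
proof -
  interpret banach_action scaleA scaleX scaleY act
    by (rule assms(1))
  interpret A: hilbert_space_over scaleA ip
    by (rule assms(2))
  note e = assms(3)
  have weak: "summable (\<lambda>n. \<bar>g (act (e n) x)\<bar>)" if "bounded_linear g" for x and g :: "'y \<Rightarrow> real"
  proof (rule summable_comparison_test)
    show "summable (\<lambda>n. norm (Y.complexify g (act (e n) x)))"
      using assms(4)[of x] Y.linear_complexify[of g] Y.continuous_complexify[of g] that
      by (auto simp: weakly_absolutely_convergent_def bounded_linear.linear)
    show "\<exists>N. \<forall>n\<ge>N. norm \<bar>g (act (e n) x)\<bar> \<le> norm (Y.complexify g (act (e n) x))"
      using Y.abs_le_norm_complexify[of g] by simp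
  qed
  obtain K where K: "K > 0"
    and signed: "\<And>N D x. norm (\<Sum>n<N. signs D n *\<^sub>R act (e n) x) \<le> K * norm x"
    using signed_partial_sums_bounded[of "\<lambda>n. act (e n)", OF bounded_linear_act_right weak] by blast
  have main: "norm (\<Sum>k<m. act (a k) (x k)) \<le> 8 * K * M * L"
    if M: "\<And>k. k < m \<Longrightarrow> norm (a k) \<le> M" and "M \<ge> 0"
      and L: "\<And>P. P \<subseteq> {..<m} \<Longrightarrow> norm (\<Sum>k\<in>P. x k) \<le> L"
    for m M L and a :: "nat \<Rightarrow> 'a" and x :: "nat \<Rightarrow> 'x"
  proof -
    obtain g where g: "linear g" "\<And>y. \<bar>g y\<bar> \<le> norm y"
      and g_norming: "g (\<Sum>k<m. act (a k) (x k)) = norm (\<Sum>k<m. act (a k) (x k))"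
      using norming_functional[of "\<Sum>k<m. act (a k) (x k)"] by blast
    have bg: "bounded_linear g"
      using g by (intro bounded_linear_intro[of g 1]) (auto simp: linear_add linear_scale)
    \<comment> \<open>Up to sign, \<open>h\<close> is the imaginary part of \<open>f\<close>. It satisfies the same bound as \<open>g\<close>, so that Littlewood's
      inequality applies to both parts and contributes \<open>4 K L\<close> each.\<close>
    define h where "h = (\<lambda>y. g (scaleY imag_unit y))"
    have h: "linear h" "\<And>y. \<bar>h y\<bar> \<le> norm y"
    proof -
      show "linear h"
        unfolding h_def
        by (intro linear_compose[OF _ g(1), unfolded o_def]
            bounded_linear.linear[OF Y.bounded_linear_scale])
      show "\<bar>h y\<bar> \<le> norm y" for y
      proof -
        have "\<bar>h y\<bar> \<le> norm (imag_unit :: 'f) * norm y"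
          unfolding h_def using g(2)[of "scaleY imag_unit y"] by (simp add: Y.norm_scale)
        also have "\<dots> \<le> 1 * norm y"
          by (intro mult_right_mono norm_imag_unit_le_1) auto
        finally show ?thesis
          by simp
      qed
    qed
    define f where "f = Y.complexify g"
    have f: "Vector_Spaces.linear scaleY (*) f" "continuous_on UNIV f"
      unfolding f_def by (intro Y.linear_complexify g(1) Y.continuous_complexify bg)+
    define u where "u k N = L2_set (\<lambda>n. norm (f (act (e n) (x k)))) {..<N}" for k N
    have "(\<Sum>k<m. u k N) \<le> 8 * K * L" for N
    proof -
      have "u k N \<le> L2_set (\<lambda>n. g (act (e n) (x k))) {..<N} + L2_set (\<lambda>n. h (act (e n) (x k))) {..<N}"
        for k
      proof -
        have "u k N \<le> L2_set (\<lambda>n. \<bar>g (act (e n) (x k))\<bar> + \<bar>h (act (e n) (x k))\<bar>) {..<N}"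
          unfolding u_def f_def h_def by (intro L2_set_mono Y.norm_complexify_le) auto
        also have "\<dots> \<le> L2_set (\<lambda>n. \<bar>g (act (e n) (x k))\<bar>) {..<N}
            + L2_set (\<lambda>n. \<bar>h (act (e n) (x k))\<bar>) {..<N}"
          by (rule L2_set_triangle_ineq)
        finally show ?thesis
          by (simp add: L2_set_def)
      qed
      then have "(\<Sum>k<m. u k N) \<le> (\<Sum>k<m. L2_set (\<lambda>n. g (act (e n) (x k))) {..<N})
          + (\<Sum>k<m. L2_set (\<lambda>n. h (act (e n) (x k))) {..<N})"
        by (simp add: sum_mono flip: sum.distrib)
      also have "\<dots> \<le> 4 * K * L + 4 * K * L"
        using K by (intro add_mono Littlewood_mixed_norm g h L signed
            bounded_linear.linear[OF bounded_linear_act_right]) auto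
      finally show ?thesis
        by simp
    qed
    moreover have "incseq (u k)" for k
      unfolding u_def L2_set_def by (intro monoI real_sqrt_le_mono sum_mono2) auto
    ultimately obtain D where D: "\<And>k N. k \<in> {..<m} \<Longrightarrow> u k N \<le> D k"
      and sum_D: "(\<Sum>k<m. D k) \<le> 8 * K * L"
      using sum_of_bounded_monotone_limits[of "{..<m}" u "8 * K * L"] by (auto simp: u_def)
    have f_le: "norm (f (act (a k) (x k))) \<le> M * D k" if "k < m" for k
    proof -
      have "norm (f (act (a k) (x k))) \<le> norm (a k) * D k"
      proof (rule A.norm_linear_functional_le[OF e])
        show "Vector_Spaces.linear scaleA (*) (\<lambda>a. f (act a (x k)))"
          using Vector_Spaces.linear_compose[OF linear_left f(1)] by (simp add: o_def)
        show "continuous_on UNIV (\<lambda>a. f (act a (x k)))"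
          using continuous_on_compose2[OF f(2) continuous_act_left] by simp
        show "L2_set (\<lambda>n. norm (f (act (e n) (x k)))) {..<N} \<le> D k" for N
          using D[of k N] that by (simp add: u_def)
      qed
      also have "\<dots> \<le> M * D k"
        using D[of k 0] M[OF that] that by (intro mult_right_mono) (auto simp: u_def)
      finally show ?thesis .
    qed
    interpret f: Vector_Spaces.linear scaleY "(*)" f
      by (rule f(1))
    have "norm (\<Sum>k<m. act (a k) (x k)) \<le> norm (f (\<Sum>k<m. act (a k) (x k)))"
      using Y.abs_le_norm_complexify[of g "\<Sum>k<m. act (a k) (x k)"] g_norming by (simp add: f_def)
    also have "\<dots> \<le> (\<Sum>k<m. M * D k)"
      unfolding f.sum by (rule sum_norm_le) (use f_le in auto)
    also have "\<dots> \<le> M * (8 * K * L)"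
      unfolding sum_distrib_left[symmetric] by (intro mult_left_mono sum_D \<open>M \<ge> 0\<close>)
    finally show ?thesis
      by (simp add: mult_ac)
  qed
  show ?thesis
    unfolding unconditional_action_def
  proof (intro exI[of _ "8 * K"] conjI allI impI)
    show "8 * K > 0"
      using K by simp
    fix m :: nat and a :: "nat \<Rightarrow> 'a" and x :: "nat \<Rightarrow> 'x"
    assume "m \<ge> 1"
    have M: "norm (a k) \<le> (MAX k\<in>{..<m}. norm (a k))" if "k < m" for k
      using that by (intro Max_ge) auto
    show "norm (\<Sum>k<m. act (a k) (x k))
        \<le> 8 * K * (MAX k\<in>{..<m}. norm (a k)) * (MAX F\<in>Pow {..<m}. norm (\<Sum>k\<in>F. x k))"
    proof (rule main[OF M])
      show "0 \<le> (MAX k\<in>{..<m}. norm (a k))"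
        using M[of 0] \<open>m \<ge> 1\<close> norm_ge_zero[of "a 0"] by linarith
      show "norm (\<Sum>k\<in>P. x k) \<le> (MAX F\<in>Pow {..<m}. norm (\<Sum>k\<in>F. x k))" if "P \<subseteq> {..<m}" for P
        using that by (intro Max_ge) auto
    qed
  qed
qed

end
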